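(* Let $1 \le S < N$, let $\mathbf{H} \in \mathbb{R}^{M\times N}$ satisfy $\mathrm{spark}(\mathbf{H}) > S$, let $\sigma^2 > 0$, and consider the sparse linear model $\mathbf{y} = \mathbf{H}\mathbf{x} + \mathbf{n}$ with unknown nonrandom parameter $\mathbf{x} \in \mathcal{X}_S$ and $\mathbf{n} \sim \mathcal{N}(\mathbf{0}, \sigma^2 \mathbf{I})$. Let $\boldsymbol{\gamma} = (\gamma_1,\dots,\gamma_N)^T : \mathcal{X}_S \to \mathbb{R}^N$ be a differentiable mean function (in the sense specified in the context), and let $\hat{\mathbf{x}}(\cdot) : \mathbb{R}^M \to \mathbb{R}^N$ be an estimator whose mean equals $\boldsymbol{\gamma}(\mathbf{x})$ for all $\mathbf{x} \in \mathcal{X}_S$, i.e., $\mathsf{E}_{\mathbf{x}}\{\hat{\mathbf{x}}(\mathbf{y})\} = \boldsymbol{\gamma}(\mathbf{x})$ for all $\mathbf{x} \in \mathcal{X}_S$. Then for any given parameter vector $\mathbf{x}_0 \in \mathcal{X}_S$, the variance of $\hat{\mathbf{x}}(\cdot)$ at $\mathbf{x} = \mathbf{x}_0$ satisfies $$ v(\hat{\mathbf{x}}(\cdot);\mathbf{x}_0) \;\ge\; \sum_{k=1}^N L^*_{\gamma_k}(\mathbf{x}_0), \qquad L^*_{\gamma_k}(\mathbf{x}_0) := \max_{\mathcal{K} \subseteq \{1,\dots,N\},\, |\mathcal{K}| = S} L_{\gamma_k}^{\mathcal{K}}(\mathbf{x}_0), $$ where, for each $k$ and each index set $\mathcal{K}$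 with $|\mathcal{K}| = S$, $$ L_{\gamma_k}^{\mathcal{K}}(\mathbf{x}_0) := \beta_{\mathbf{x}_0,\mathcal{K}}^2 \Big[ \sigma^2\, \mathbf{r}_{k,\mathcal{K}}^T(\mathbf{s}_{0,\mathcal{K}})\, (\mathbf{H}_{\mathcal{K}}^T \mathbf{H}_{\mathcal{K}})^{-1}\, \mathbf{r}_{k,\mathcal{K}}(\mathbf{s}_{0,\mathcal{K}}) + \gamma_k^2\big(\mathbf{x}_{\mathcal{K}}(\mathbf{s}_{0,\mathcal{K}})\big) \Big] - \gamma_k^2(\mathbf{x}_0), $$ with $\beta_{\mathbf{x}_0,\mathcal{K}}$, $\mathbf{s}_{0,\mathcal{K}}$, $\mathbf{x}_{\mathcal{K}}(\cdot)$, $\mathbf{r}_{k,\mathcal{K}}(\cdot)$ and $\mathbf{H}_{\mathcal{K}}$ as defined in the context.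
   Context: $\|\mathbf{x}\|_0$ is the number of nonzero entries of $\mathbf{x}$, and $\mathcal{X}_S := \{\mathbf{x} \in \mathbb{R}^N : \|\mathbf{x}\|_0 \le S\}$. $\mathrm{spark}(\mathbf{H})$ is the minimum number of linearly dependent columns of $\mathbf{H}$; the condition $\mathrm{spark}(\mathbf{H}) > S$ means that any $S$ columns of $\mathbf{H}$ are linearly independent (so $M \ge S$; $M < N$ is allowed). $\mathsf{E}_{\mathbf{x}}\{\cdot\}$ denotes expectation when $\mathbf{y}$ has the probability density $f(\mathbf{y};\mathbf{x}) = (2\pi\sigma^2)^{-M/2} \exp\big(-\frac{1}{2\sigma^2}\|\mathbf{y} - \mathbf{H}\mathbf{x}\|_2^2\big)$. An estimator is a (measurable) function of $\mathbf{y}$. Its variance at $\mathbf{x}_0$ is $v(\hat{\mathbf{x}}(\cdot);\mathbf{x}_0) := \mathsf{E}_{\mathbf{x}_0}\big\{ \|\hat{\mathbf{x}}(\mathbf{y}) - \mathsf{E}_{\mathbf{x}_0}\{\hat{\mathbf{x}}(\mathbf{y})\}\|_2^2 \big\}$. For an index set $\mathcal{K} = \{k_1,\dots,k_S\} \subseteq \{1,\dots,N\}$ of $S$ distinct indices: - $\mathbf{H}_{\mathcal{K}} \in \mathbb{R}^{M\times S}$ is the submatrix of $\mathbf{H}$ whose $i$th column is the $k_i$th column of $\mathbf{H}$; it has full column rank by the spark condition. - $\mathbf{H}_{\mathcal{K}}^\dagger := (\mathbf{H}_{\mathcal{K}}^T\mathbf{H}_{\mathcal{K}})^{-1}\mathbf{H}_{\mathcal{K}}^T$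 and $\mathbf{P}_{\mathcal{K}} := \mathbf{H}_{\mathcal{K}}\mathbf{H}_{\mathcal{K}}^\dagger$ (the orthogonal projection onto the range of $\mathbf{H}_{\mathcal{K}}$). - $\mathbf{s}_{0,\mathcal{K}} := \mathbf{H}_{\mathcal{K}}^\dagger \mathbf{H}\mathbf{x}_0 \in \mathbb{R}^S$. - $\beta_{\mathbf{x}_0,\mathcal{K}} := \exp\big(-\frac{1}{2\sigma^2}\|(\mathbf{I}-\mathbf{P}_{\mathcal{K}})\mathbf{H}\mathbf{x}_0\|_2^2\big)$. - For $\mathbf{s} \in \mathbb{R}^S$, $\mathbf{x}_{\mathcal{K}}(\mathbf{s}) \in \mathcal{X}_S$ is the vector whose $k_i$th entry is $s_i$ for $i=1,\dots,S$ and whose remaining $N-S$ entries are zero. - $\mathbf{r}_{k,\mathcal{K}}(\mathbf{s}) := \partial \gamma_k(\mathbf{x}_{\mathcal{K}}(\mathbf{s}))/\partial \mathbf{s} \in \mathbb{R}^S$ is the gradient, whose $l$th entry is $\partial\gamma_k(\mathbf{x}_{\mathcal{K}}(\mathbf{s}))/\partial s_l$. Differentiability of $\boldsymbol{\gamma}$ (equivalently of the bias function $\mathbf{c}(\mathbf{x}) = \boldsymbol{\gamma}(\mathbf{x}) - \mathbf{x}$) means that for every $k$ and every $\mathcal{K}$ with $|\mathcal{K}|=S$, the function $\mathbf{s} \mapsto \gamma_k(\mathbf{x}_{\mathcal{K}}(\mathbf{s}))$ is differentiable on $\mathbb{R}^S$. *)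

theory Defs
  imports "HOL-Analysis.Analysis"
begin

text \<open>
  The dimensions \<open>N\<close>, \<open>M\<close>, \<open>S\<close> are the cardinalities of the finite index types
  \<open>'n\<close>, \<open>'m\<close>, \<open>'s\<close>, so that \<open>S \<ge> 1\<close> holds automatically.  An index set
  \<open>K = {k\<^sub>1, \<dots>, k\<^sub>S}\<close> is presented through an enumeration \<open>\<kappa> :: 's \<Rightarrow> 'n\<close>, an injective map
  with range \<open>K\<close>, where \<open>\<kappa> i\<close> plays the role of \<open>k\<^sub>i\<close>.
\<close>

definition l0_norm :: "real ^ 'n \<Rightarrow> nat" where
  "l0_norm x = card {i. x $ i \<noteq> 0}"

definition sparse_vectors :: "nat \<Rightarrow> (real ^ 'n) set" where
  "sparse_vectors S = {x. l0_norm x \<le> S}"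

text \<open>Dependence of the indexed family of columns: a repeated column counts as dependent.\<close>

definition dependent_columns :: "real ^ 'n ^ 'm \<Rightarrow> 'n set \<Rightarrow> bool" where
  "dependent_columns H J \<longleftrightarrow>
     (\<exists>c. (\<exists>j\<in>J. c j \<noteq> 0) \<and> (\<Sum>j\<in>J. c j *\<^sub>R column j H) = 0)"

text \<open>The spark is \<open>\<infinity>\<close> if all columns together are linearly independent.\<close>

definition spark :: "real ^ 'n ^ 'm \<Rightarrow> enat" where
  "spark H = (INF J \<in> {J. dependent_columns H J}. enat (card J))"

definition obs_density :: "real ^ 'n ^ 'm \<Rightarrow> real \<Rightarrow> real ^ 'n \<Rightarrow> real ^ 'm \<Rightarrow> real" where
  "obs_density H \<sigma> x y =
     (2 * pi * \<sigma>\<^sup>2) powr (- (real CARD('m) / 2)) * exp (- (1 / (2 * \<sigma>\<^sup>2)) * (norm (y - H *v x))\<^sup>2)"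

definition obs_measure :: "real ^ 'n ^ 'm \<Rightarrow> real \<Rightarrow> real ^ 'n \<Rightarrow> (real ^ 'm) measure" where
  "obs_measure H \<sigma> x = density lborel (\<lambda>y. ennreal (obs_density H \<sigma> x y))"

text \<open>
  The mean has to exist: the Bochner integral of a non-integrable function is \<open>0\<close> by convention,
  hence the use of \<^const>\<open>has_bochner_integral\<close>, which includes integrability.
\<close>

definition has_mean_function ::
  "real ^ 'n ^ 'm \<Rightarrow> real \<Rightarrow> (real ^ 'm \<Rightarrow> real ^ 'n) \<Rightarrow> (real ^ 'n) set
     \<Rightarrow> (real ^ 'n \<Rightarrow> real ^ 'n) \<Rightarrow> bool" where
  "has_mean_function H \<sigma> xhat X \<gamma> \<longleftrightarrow>
     (\<forall>x\<in>X. has_bochner_integral (obs_measure H \<sigma> x) xhat (\<gamma> x))"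

text \<open>The variance may be infinite and is therefore a nonnegative extended integral.\<close>

definition est_variance ::
  "real ^ 'n ^ 'm \<Rightarrow> real \<Rightarrow> (real ^ 'm \<Rightarrow> real ^ 'n) \<Rightarrow> real ^ 'n \<Rightarrow> ennreal" where
  "est_variance H \<sigma> xhat x0 =
     (\<integral>\<^sup>+ y. ennreal ((norm (xhat y - integral\<^sup>L (obs_measure H \<sigma> x0) xhat))\<^sup>2)
        \<partial>obs_measure H \<sigma> x0)"

definition sub_matrix :: "real ^ 'n ^ 'm \<Rightarrow> ('s \<Rightarrow> 'n) \<Rightarrow> real ^ 's ^ 'm" where
  "sub_matrix H \<kappa> = (\<chi> i l. H $ i $ \<kappa> l)"

definition gram_inv :: "real ^ 'n ^ 'm \<Rightarrow> ('s \<Rightarrow> 'n) \<Rightarrow> real ^ 's ^ 's" where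
  "gram_inv H \<kappa> = matrix_inv (transpose (sub_matrix H \<kappa>) ** sub_matrix H \<kappa>)"

definition sub_pinv :: "real ^ 'n ^ 'm \<Rightarrow> ('s \<Rightarrow> 'n) \<Rightarrow> real ^ 'm ^ 's" where
  "sub_pinv H \<kappa> = gram_inv H \<kappa> ** transpose (sub_matrix H \<kappa>)"

definition sub_proj :: "real ^ 'n ^ 'm \<Rightarrow> ('s::finite \<Rightarrow> 'n) \<Rightarrow> real ^ 'm ^ 'm" where
  "sub_proj H \<kappa> = sub_matrix H \<kappa> ** sub_pinv H \<kappa>"

definition s0_vec :: "real ^ 'n ^ 'm \<Rightarrow> ('s \<Rightarrow> 'n) \<Rightarrow> real ^ 'n \<Rightarrow> real ^ 's" where
  "s0_vec H \<kappa> x0 = sub_pinv H \<kappa> *v (H *v x0)"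

definition beta_fac :: "real ^ 'n ^ 'm \<Rightarrow> real \<Rightarrow> ('s::finite \<Rightarrow> 'n) \<Rightarrow> real ^ 'n \<Rightarrow> real" where
  "beta_fac H \<sigma> \<kappa> x0 =
     exp (- (1 / (2 * \<sigma>\<^sup>2)) * (norm ((mat 1 - sub_proj H \<kappa>) *v (H *v x0)))\<^sup>2)"

definition embed_vec :: "('s \<Rightarrow> 'n) \<Rightarrow> real ^ 's \<Rightarrow> real ^ 'n" where
  "embed_vec \<kappa> s = (\<chi> j. if j \<in> range \<kappa> then s $ inv \<kappa> j else 0)"

text \<open>The vector of partial derivatives of \<open>s \<mapsto> \<gamma>\<^sub>k (x\<^sub>K (s))\<close>.\<close>

definition grad_vec ::
  "(real ^ 'n \<Rightarrow> real ^ 'n) \<Rightarrow> 'n \<Rightarrow> ('s::finite \<Rightarrow> 'n) \<Rightarrow> real ^ 's \<Rightarrow> real ^ 's" where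
  "grad_vec \<gamma> k \<kappa> s = (\<chi> l. deriv (\<lambda>t. \<gamma> (embed_vec \<kappa> (s + t *\<^sub>R axis l 1)) $ k) 0)"

definition L_bound ::
  "real ^ 'n ^ 'm \<Rightarrow> real \<Rightarrow> (real ^ 'n \<Rightarrow> real ^ 'n) \<Rightarrow> 'n \<Rightarrow> ('s::finite \<Rightarrow> 'n) \<Rightarrow> real ^ 'n \<Rightarrow> real" where
  "L_bound H \<sigma> \<gamma> k \<kappa> x0 =
     (let s0 = s0_vec H \<kappa> x0; r = grad_vec \<gamma> k \<kappa> s0 in
      (beta_fac H \<sigma> \<kappa> x0)\<^sup>2 *
        (\<sigma>\<^sup>2 * (r \<bullet> (gram_inv H \<kappa> *v r)) + (\<gamma> (embed_vec \<kappa> s0) $ k)\<^sup>2) - (\<gamma> x0 $ k)\<^sup>2)"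

text \<open>A choice, for every index set of size \<open>S\<close>, of an enumeration of its elements.\<close>

definition is_enumeration :: "('n set \<Rightarrow> 's \<Rightarrow> 'n) \<Rightarrow> bool" where
  "is_enumeration e \<longleftrightarrow> (\<forall>K. card K = CARD('s) \<longrightarrow> bij_betw (e K) UNIV K)"

definition differentiable_mean :: "('n set \<Rightarrow> 's::finite \<Rightarrow> 'n) \<Rightarrow> (real ^ 'n \<Rightarrow> real ^ 'n) \<Rightarrow> bool" where
  "differentiable_mean e \<gamma> \<longleftrightarrow>
     (\<forall>k K. card K = CARD('s) \<longrightarrow> (\<lambda>s. \<gamma> (embed_vec (e K) s) $ k) differentiable_on UNIV)"

definition L_star ::
  "real ^ 'n ^ 'm \<Rightarrow> real \<Rightarrow> ('n set \<Rightarrow> 's::finite \<Rightarrow> 'n) \<Rightarrow> (real ^ 'n \<Rightarrow> real ^ 'n)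
     \<Rightarrow> 'n \<Rightarrow> real ^ 'n \<Rightarrow> real" where
  "L_star H \<sigma> e \<gamma> k x0 = Max ((\<lambda>K. L_bound H \<sigma> \<gamma> k (e K) x0) ` {K. card K = CARD('s)})"

end

theory Submission
  imports Defs "HOL-Probability.Distributions" "HOL-Real_Asymp.Real_Asymp"
begin

text \<open>
  For a fixed index set \<open>K\<close> this is a Barankin-type argument.  Let \<open>\<rho>\<^sub>s\<close> be the likelihood ratio of
  the densities at \<open>x\<^sub>K (s)\<close> and at \<open>x\<^sub>0\<close>.  Under \<open>x\<^sub>0\<close>, the inner product of \<open>\<rho>\<^sub>s\<close> and \<open>\<rho>\<^sub>t\<close> is
  \<open>\<beta>\<^sup>-\<^sup>2 exp ((s - s\<^sub>0)\<^sup>T G (t - s\<^sub>0) / \<sigma>\<^sup>2)\<close> with \<open>G\<close> the Gram matrix, and the inner product of the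
  \<open>k\<close>-th component of the estimator with \<open>\<rho>\<^sub>s\<close> is \<open>\<gamma>\<^sub>k (x\<^sub>K (s))\<close>.  Projecting that component onto
  the span of \<open>\<rho>\<close> at \<open>s\<^sub>0\<close> and of a difference quotient of \<open>\<rho>\<close> at \<open>s\<^sub>0\<close> in the direction
  \<open>\<sigma>\<^sup>2 G\<^sup>-\<^sup>1 r\<close>, and letting the step tend to \<open>0\<close>, bounds its second moment from below by
  \<open>\<beta>\<^sup>2 (\<sigma>\<^sup>2 r\<^sup>T G\<^sup>-\<^sup>1 r + \<gamma>\<^sub>k\<^sup>2)\<close>.  Only difference quotients occur, so no differentiation under the
  integral sign is needed.
\<close>

section \<open>The Gaussian density and its probability measure\<close>

lemma obs_density_pos: "\<sigma>\<^sup>2 > 0 \<Longrightarrow> obs_density H \<sigma> x y > 0"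
  by (simp add: obs_density_def)

lemma borel_measurable_obs_density [measurable]: "obs_density H \<sigma> x \<in> borel_measurable borel"
  unfolding obs_density_def by measurable

text \<open>The covariance is a multiple of the identity, so the coordinates are independent. The
  factorisation reduces the total mass to one-dimensional integrals over
  \<open>lborel\<close>.\<close>

lemma obs_density_eq_prod_normal_density:
  fixes H :: "real ^ 'n ^ 'm"
  assumes "\<sigma>\<^sup>2 > 0"
  shows "obs_density H \<sigma> x y = (\<Prod>b\<in>Basis. normal_density ((H *v x) \<bullet> b) \<sigma> (y \<bullet> b))"
proof -
  have "(\<Prod>b\<in>(Basis :: (real ^ 'm) set). 1 / sqrt (2 * pi * \<sigma>\<^sup>2)) =
      (2 * pi * \<sigma>\<^sup>2) powr (- (real CARD('m) / 2))"
  proof -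
    have "(\<Prod>b\<in>(Basis :: (real ^ 'm) set). 1 / sqrt (2 * pi * \<sigma>\<^sup>2)) =
        ((2 * pi * \<sigma>\<^sup>2) powr - (1 / 2)) powr real CARD('m)"
      using assms
      by (subst powr_realpow) (simp_all add: powr_minus powr_half_sqrt inverse_eq_divide)
    then show ?thesis
      by (simp add: powr_powr)
  qed
  moreover have "(\<Prod>b\<in>(Basis :: (real ^ 'm) set). exp (- (y \<bullet> b - (H *v x) \<bullet> b)\<^sup>2 / (2 * \<sigma>\<^sup>2))) =
      exp (- (1 / (2 * \<sigma>\<^sup>2)) * (norm (y - H *v x))\<^sup>2)"
  proof -
    have "(norm (y - H *v x))\<^sup>2 = (\<Sum>b\<in>Basis. (y \<bullet> b - (H *v x) \<bullet> b)\<^sup>2)"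
      unfolding power2_norm_eq_inner
      by (subst euclidean_inner) (simp add: inner_diff_left power2_eq_square)
    then show ?thesis
      by (simp add: exp_sum [symmetric] sum_negf sum_divide_distrib)
  qed
  ultimately show ?thesis
    unfolding normal_density_def prod.distrib obs_density_def by simp
qed

lemma has_bochner_integral_obs_density:
  assumes "\<sigma>\<^sup>2 > 0"
  shows "has_bochner_integral lborel (obs_density H \<sigma> x) 1"
proof (rule has_bochner_integral_nn_integral)
  \<comment> \<open>Only \<open>\<sigma>\<^sup>2 > 0\<close> is known, so \<sigma> may be negative;
    the density depends on \<sigma> only through its square, and |\<sigma>| can serve as the
    standard deviation.\<close>
  have \<sigma>: "normal_density m \<sigma> = normal_density m \<bar>\<sigma>\<bar>" for m
    by (simp add: normal_density_def fun_eq_iff)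
  have one: "(\<integral>\<^sup>+ t. ennreal (normal_density m \<sigma> t) \<partial>lborel) = 1" for m
    unfolding \<sigma> using assms
    by (subst nn_integral_eq_integral) (auto intro: integrable_normal_density)
  have "(\<integral>\<^sup>+ y. ennreal (obs_density H \<sigma> x y) \<partial>lborel) =
      (\<integral>\<^sup>+ y. (\<Prod>b\<in>Basis. ennreal (normal_density ((H *v x) \<bullet> b) \<sigma> (y \<bullet> b))) \<partial>lborel)"
    by (simp add: obs_density_eq_prod_normal_density [OF assms] prod_ennreal)
  also have "\<dots> = 1"
    by (subst nn_integral_lborel_prod) (simp_all add: one)
  finally show "(\<integral>\<^sup>+ y. ennreal (obs_density H \<sigma> x y) \<partial>lborel) = ennreal 1"
    by simp
qed (use assms in \<open>auto intro!: AE_I2 less_imp_le obs_density_pos\<close>)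

lemma prob_space_obs_measure:
  assumes "\<sigma>\<^sup>2 > 0"
  shows "prob_space (obs_measure H \<sigma> x)"
proof
  have "(\<integral>\<^sup>+ y. ennreal (obs_density H \<sigma> x y) \<partial>lborel) = ennreal 1"
    using has_bochner_integral_obs_density [OF assms, of H x] obs_density_pos [OF assms, of H x]
    by (subst nn_integral_eq_integral)
      (auto simp: has_bochner_integral_iff intro!: AE_I2 less_imp_le)
  then show "emeasure (obs_measure H \<sigma> x) (space (obs_measure H \<sigma> x)) = 1"
    by (simp add: obs_measure_def emeasure_density)
qed

lemma sets_obs_measure [simp, measurable_cong]: "sets (obs_measure H \<sigma> x) = sets borel"
  by (simp add: obs_measure_def)

lemma has_bochner_integral_obs_measure_iff:
  fixes f :: "real ^ 'm \<Rightarrow> real"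
  assumes "\<sigma>\<^sup>2 > 0" "f \<in> borel_measurable borel"
  shows "has_bochner_integral (obs_measure H \<sigma> x) f c \<longleftrightarrow>
    has_bochner_integral lborel (\<lambda>y. obs_density H \<sigma> x y * f y) c"
  using assms obs_density_pos [OF assms(1), of H x]
  by (simp add: obs_measure_def has_bochner_integral_iff integrable_density integral_density
      less_imp_le)

section \<open>Likelihood ratios and their inner products\<close>

definition lik_ratio ::
  "real ^ 'n ^ 'm \<Rightarrow> real \<Rightarrow> real ^ 'n \<Rightarrow> real ^ 'n \<Rightarrow> real ^ 'm \<Rightarrow> real" where
  "lik_ratio H \<sigma> x0 x y = obs_density H \<sigma> x y / obs_density H \<sigma> x0 y"

lemma borel_measurable_lik_ratio [measurable]: "lik_ratio H \<sigma> x0 x \<in> borel_measurable borel"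
  unfolding lik_ratio_def by measurable

text \<open>Change of measure: the density at \<open>x0\<close> is positive everywhere and cancels.
  All means thereby become inner products under the single measure at \<open>x0\<close>.\<close>

lemma has_bochner_integral_mult_lik_ratio:
  fixes f :: "real ^ 'm \<Rightarrow> real"
  assumes "\<sigma>\<^sup>2 > 0" and [measurable]: "f \<in> borel_measurable borel"
    and "has_bochner_integral (obs_measure H \<sigma> x) f c"
  shows "has_bochner_integral (obs_measure H \<sigma> x0) (\<lambda>y. f y * lik_ratio H \<sigma> x0 x y) c"
proof -
  have "obs_density H \<sigma> x0 y * (f y * lik_ratio H \<sigma> x0 x y) = obs_density H \<sigma> x y * f y" for y
    using obs_density_pos [OF assms(1), of H x0 y] by (simp add: lik_ratio_def)
  then have "(\<lambda>y. obs_density H \<sigma> x0 y * (f y * lik_ratio H \<sigma> x0 x y)) =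
      (\<lambda>y. obs_density H \<sigma> x y * f y)"
    by (rule ext)
  then show ?thesis
    using assms by (simp add: has_bochner_integral_obs_measure_iff)
qed

text \<open>Complete the square after centring at \<open>H *v x0\<close>: |z - u|^2 + |z - v|^2 and
  |z - u - v|^2 + |z|^2 differ only by 2 (u \<bullet> v), which does not depend on
  \<open>y\<close>.\<close>

lemma obs_density_mult:
  fixes H :: "real ^ 'n ^ 'm"
  shows "obs_density H \<sigma> x y * obs_density H \<sigma> x' y =
    exp ((H *v (x - x0)) \<bullet> (H *v (x' - x0)) / \<sigma>\<^sup>2) *
      (obs_density H \<sigma> (x + x' - x0) y * obs_density H \<sigma> x0 y)"
proof (cases "\<sigma> = 0")
  case True
  \<comment> \<open>Here the \<open>powr\<close> factor has base 0 and is 0 by convention, so both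
    sides vanish.\<close>
  then show ?thesis by (simp add: obs_density_def)
next
  case False
  define u v z where "u = H *v (x - x0)" and "v = H *v (x' - x0)" and "z = y - H *v x0"
  have *: "y - H *v x = z - u" "y - H *v x' = z - v" "y - H *v (x + x' - x0) = z - u - v"
    by (simp_all add: u_def v_def z_def matrix_vector_mult_diff_distrib
        matrix_vector_right_distrib)
  have "(norm (z - u))\<^sup>2 + (norm (z - v))\<^sup>2 = (norm (z - u - v))\<^sup>2 + (norm z)\<^sup>2 - 2 * (u \<bullet> v)"
    by (simp add: power2_norm_eq_inner inner_diff_left inner_diff_right inner_commute)
  then have "- (1 / (2 * \<sigma>\<^sup>2)) * (norm (z - u))\<^sup>2 + - (1 / (2 * \<sigma>\<^sup>2)) * (norm (z - v))\<^sup>2 =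
      u \<bullet> v / \<sigma>\<^sup>2 + (- (1 / (2 * \<sigma>\<^sup>2)) * (norm (z - u - v))\<^sup>2 + - (1 / (2 * \<sigma>\<^sup>2)) * (norm z)\<^sup>2)"
    using False by (simp add: field_simps)
  then have "exp (- (1 / (2 * \<sigma>\<^sup>2)) * (norm (z - u))\<^sup>2) * exp (- (1 / (2 * \<sigma>\<^sup>2)) * (norm (z - v))\<^sup>2) =
      exp (u \<bullet> v / \<sigma>\<^sup>2) * (exp (- (1 / (2 * \<sigma>\<^sup>2)) * (norm (z - u - v))\<^sup>2) *
        exp (- (1 / (2 * \<sigma>\<^sup>2)) * (norm z)\<^sup>2))"
    by (simp only: exp_add [symmetric])
  then show ?thesis
    unfolding obs_density_def * u_def [symmetric] v_def [symmetric] z_def [symmetric]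
    by (simp only: mult_ac)
qed

text \<open>After one density at \<open>x0\<close> cancels, what remains is a constant times the
  density at \<open>x + x' - x0\<close>, which has mass 1 even if that vector is not sparse.\<close>

lemma has_bochner_integral_lik_ratio_mult:
  assumes "\<sigma>\<^sup>2 > 0"
  shows "has_bochner_integral (obs_measure H \<sigma> x0)
    (\<lambda>y. lik_ratio H \<sigma> x0 x y * lik_ratio H \<sigma> x0 x' y)
    (exp ((H *v (x - x0)) \<bullet> (H *v (x' - x0)) / \<sigma>\<^sup>2))" (is "has_bochner_integral _ _ ?c")
proof -
  have "obs_density H \<sigma> x0 y * (lik_ratio H \<sigma> x0 x y * lik_ratio H \<sigma> x0 x' y) =
      ?c * obs_density H \<sigma> (x + x' - x0) y" for y
    using obs_density_pos [OF assms, of H x0 y] obs_density_mult [of H \<sigma> x y x' x0]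
    by (simp add: lik_ratio_def field_simps)
  then show ?thesis
    using has_bochner_integral_mult_right
      [OF has_bochner_integral_obs_density [OF assms, of H "x + x' - x0"], of ?c] assms
    by (simp add: has_bochner_integral_obs_measure_iff)
qed

text \<open>Expand the nonnegative integral of
  \<open>(f - a \<rho>\<^sub>1 - b \<rho>\<^sub>2)\<^sup>2\<close>. Keeping \<open>a\<close> and
  \<open>b\<close> free avoids inverting the 2 by 2 matrix of kernel values; good coefficients are
  chosen later.\<close>

lemma second_moment_ge:
  fixes f :: "real ^ 'm \<Rightarrow> real"
  assumes "\<sigma>\<^sup>2 > 0" and [measurable]: "f \<in> borel_measurable borel"
    and sq: "integrable (obs_measure H \<sigma> x0) (\<lambda>y. (f y)\<^sup>2)"
    and m1: "has_bochner_integral (obs_measure H \<sigma> x1) f m1"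
    and m2: "has_bochner_integral (obs_measure H \<sigma> x2) f m2"
  defines "k \<equiv> \<lambda>x x'. exp ((H *v (x - x0)) \<bullet> (H *v (x' - x0)) / \<sigma>\<^sup>2)"
  shows "(\<integral>y. (f y)\<^sup>2 \<partial>obs_measure H \<sigma> x0) \<ge>
    2 * (a * m1 + b * m2) - (a\<^sup>2 * k x1 x1 + 2 * a * b * k x1 x2 + b\<^sup>2 * k x2 x2)"
proof -
  let ?M = "obs_measure H \<sigma> x0"
  let ?\<rho> = "lik_ratio H \<sigma> x0"
  have k: "has_bochner_integral ?M (\<lambda>y. ?\<rho> x y * ?\<rho> x' y) (k x x')" for x x'
    unfolding k_def by (rule has_bochner_integral_lik_ratio_mult) fact
  have "has_bochner_integral ?M
     (\<lambda>y. (f y)\<^sup>2 - 2 * (a * (f y * ?\<rho> x1 y) + b * (f y * ?\<rho> x2 y)) +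
        (a\<^sup>2 * (?\<rho> x1 y * ?\<rho> x1 y) + 2 * a * b * (?\<rho> x1 y * ?\<rho> x2 y) + b\<^sup>2 * (?\<rho> x2 y * ?\<rho> x2 y)))
     ((\<integral>y. (f y)\<^sup>2 \<partial>?M) - 2 * (a * m1 + b * m2) +
        (a\<^sup>2 * k x1 x1 + 2 * a * b * k x1 x2 + b\<^sup>2 * k x2 x2))"
    by (intro has_bochner_integral_add has_bochner_integral_diff has_bochner_integral_mult_right
        has_bochner_integral_integrable has_bochner_integral_mult_lik_ratio k assms(1,2) sq m1 m2)
  moreover have "(f y)\<^sup>2 - 2 * (a * (f y * ?\<rho> x1 y) + b * (f y * ?\<rho> x2 y)) +
        (a\<^sup>2 * (?\<rho> x1 y * ?\<rho> x1 y) + 2 * a * b * (?\<rho> x1 y * ?\<rho> x2 y) + b\<^sup>2 * (?\<rho> x2 y * ?\<rho> x2 y)) =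
      (f y - a * ?\<rho> x1 y - b * ?\<rho> x2 y)\<^sup>2" for y
    by (simp add: power2_eq_square algebra_simps)
  ultimately have "(\<integral>y. (f y - a * ?\<rho> x1 y - b * ?\<rho> x2 y)\<^sup>2 \<partial>?M) =
      (\<integral>y. (f y)\<^sup>2 \<partial>?M) - 2 * (a * m1 + b * m2) +
        (a\<^sup>2 * k x1 x1 + 2 * a * b * k x1 x2 + b\<^sup>2 * k x2 x2)"
    by (simp only: has_bochner_integral_iff)
  moreover have "0 \<le> (\<integral>y. (f y - a * ?\<rho> x1 y - b * ?\<rho> x2 y)\<^sup>2 \<partial>?M)"
    by (rule Bochner_Integration.integral_nonneg) simp
  ultimately show ?thesis by linarith
qed

section \<open>Index sets: embedding, Gram matrix, directional derivatives\<close>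

lemma matrix_vector_mult_embed_vec:
  fixes H :: "real ^ 'n ^ 'm"
  assumes "inj \<kappa>"
  shows "H *v embed_vec \<kappa> s = sub_matrix H \<kappa> *v s"
proof -
  have "(\<Sum>j\<in>UNIV. H $ i $ j * embed_vec \<kappa> s $ j) = (\<Sum>l\<in>UNIV. H $ i $ \<kappa> l * s $ l)" for i
  proof -
    have "(\<Sum>j\<in>UNIV. H $ i $ j * embed_vec \<kappa> s $ j) =
        (\<Sum>j\<in>range \<kappa>. H $ i $ j * embed_vec \<kappa> s $ j)"
      by (rule sum.mono_neutral_right) (auto simp: embed_vec_def)
    also have "\<dots> = (\<Sum>l\<in>UNIV. H $ i $ \<kappa> l * s $ l)"
      using assms by (subst sum.reindex) (auto simp: embed_vec_def)
    finally show ?thesis .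
  qed
  then show ?thesis
    by (simp add: vec_eq_iff matrix_vector_mult_def sub_matrix_def)
qed

lemma embed_vec_in_sparse_vectors:
  fixes \<kappa> :: "'s::finite \<Rightarrow> 'n::finite"
  shows "embed_vec \<kappa> s \<in> sparse_vectors CARD('s)"
proof -
  have "card {i. embed_vec \<kappa> s $ i \<noteq> 0} \<le> card (range \<kappa>)"
    by (rule card_mono) (auto simp: embed_vec_def)
  also have "\<dots> \<le> CARD('s)"
    by (rule card_image_le) simp
  finally show ?thesis
    by (simp add: sparse_vectors_def l0_norm_def)
qed

text \<open>A nonzero kernel vector would be a linear dependence among S distinct columns of
  \<open>H\<close>, forcing the spark down to at most S.\<close>

lemma inj_sub_matrix:
  fixes H :: "real ^ 'n ^ 'm" and \<kappa> :: "'s::finite \<Rightarrow> 'n"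
  assumes "inj \<kappa>" "spark H > enat CARD('s)"
    and "sub_matrix H \<kappa> *v s = 0"
  shows "s = 0"
proof (rule ccontr)
  assume "s \<noteq> 0"
  then obtain l where l: "s $ l \<noteq> 0"
    by (auto simp: vec_eq_iff)
  have "(\<Sum>j\<in>range \<kappa>. s $ inv \<kappa> j *\<^sub>R column j H) = (\<Sum>l\<in>UNIV. s $ l *\<^sub>R column (\<kappa> l) H)"
    using assms(1) by (subst sum.reindex) auto
  also have "\<dots> = sub_matrix H \<kappa> *v s"
    by (simp add: vec_eq_iff matrix_vector_mult_def sub_matrix_def column_def mult.commute)
  finally have "dependent_columns H (range \<kappa>)"
    unfolding dependent_columns_def using assms(1,3) l
    by (intro exI [of _ "\<lambda>j. s $ inv \<kappa> j"]) auto
  then have "spark H \<le> enat (card (range \<kappa>))"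
    unfolding spark_def by (intro INF_lower) simp
  then show False
    using assms(1,2) by (simp add: card_image)
qed

text \<open>With A the submatrix and G its Gram matrix, s \<bullet> G s = |A s|^2, so G has trivial
  kernel and is invertible. The nested products match the shape in which the identity is used for
  rewriting.\<close>

lemma gram_mult_gram_inv:
  fixes H :: "real ^ 'n ^ 'm" and \<kappa> :: "'s::finite \<Rightarrow> 'n"
  assumes "inj \<kappa>" "spark H > enat CARD('s)"
  shows "transpose (sub_matrix H \<kappa>) *v (sub_matrix H \<kappa> *v (gram_inv H \<kappa> *v v)) = v"
proof -
  let ?A = "sub_matrix H \<kappa>"
  let ?G = "transpose ?A ** ?A"
  have "s = 0" if "?G *v s = 0" for s
  proof -
    have "(?A *v s) \<bullet> (?A *v s) = s \<bullet> (?G *v s)"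
      by (simp add: dot_lmul_matrix inner_commute [of s] matrix_vector_mul_assoc [symmetric])
    then have "?A *v s = 0"
      using that by simp
    then show ?thesis
      using inj_sub_matrix [OF assms] by blast
  qed
  then have "invertible ?G"
    unfolding invertible_left_inverse matrix_left_invertible_ker by blast
  then have "?G ** gram_inv H \<kappa> = mat 1"
    unfolding gram_inv_def matrix_inv_def invertible_def by (rule someI2_ex) blast
  then have "(?G ** gram_inv H \<kappa>) *v v = v"
    by simp
  then show ?thesis
    by (simp only: matrix_vector_mul_assoc [symmetric])
qed

text \<open>\<open>grad_vec\<close> only records derivatives along the axes; total differentiability
  makes the derivative linear in the direction, so these determine it along every
  \<open>h\<close>.\<close>

lemma has_real_derivative_grad_vec:
  fixes \<gamma> :: "real ^ 'n \<Rightarrow> real ^ 'n" and \<kappa> :: "'s::finite \<Rightarrow> 'n"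
  assumes "(\<lambda>s. \<gamma> (embed_vec \<kappa> s) $ k) differentiable (at s)"
  shows "((\<lambda>t. \<gamma> (embed_vec \<kappa> (s + t *\<^sub>R h)) $ k) has_real_derivative grad_vec \<gamma> k \<kappa> s \<bullet> h) (at 0)"
proof -
  let ?g = "\<lambda>s. \<gamma> (embed_vec \<kappa> s) $ k"
  obtain D where D: "(?g has_derivative D) (at s)"
    using assms by (auto simp: differentiable_def)
  interpret bounded_linear D
    by (rule has_derivative_bounded_linear [OF D])
  have der: "((\<lambda>t. ?g (s + t *\<^sub>R u)) has_real_derivative D u) (at 0)" for u
  proof -
    have "((\<lambda>t. s + t *\<^sub>R u) has_derivative (\<lambda>t. t *\<^sub>R u)) (at 0)"
      by (auto intro!: derivative_eq_intros)
    then have "((\<lambda>t. ?g (s + t *\<^sub>R u)) has_derivative (\<lambda>t. D (t *\<^sub>R u))) (at 0)"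
      using has_derivative_compose [of "\<lambda>t. s + t *\<^sub>R u" "\<lambda>t. t *\<^sub>R u" 0 UNIV ?g D] D by simp
    moreover have "(\<lambda>t. D (t *\<^sub>R u)) = (*) (D u)"
      by (simp add: fun_eq_iff scaleR)
    ultimately show ?thesis
      by (simp add: has_field_derivative_def)
  qed
  have "D h = D (\<Sum>l\<in>UNIV. h $ l *\<^sub>R axis l 1)"
    using basis_expansion [of h] by (simp add: scalar_mult_eq_scaleR)
  also have "\<dots> = grad_vec \<gamma> k \<kappa> s \<bullet> h"
    by (simp add: sum scaleR inner_vec_def grad_vec_def DERIV_imp_deriv [OF der] mult.commute)
  finally show ?thesis
    using der [of h] by simp
qed

section \<open>The bound for one index set\<close>

lemma second_moment_ge_L_bound:
  fixes H :: "real ^ 'n ^ 'm" and \<kappa> :: "'s::finite \<Rightarrow> 'n" and f :: "real ^ 'm \<Rightarrow> real"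
  assumes "inj \<kappa>" and "spark H > enat CARD('s)" and \<sigma>: "\<sigma>\<^sup>2 > 0"
    and "(\<lambda>s. \<gamma> (embed_vec \<kappa> s) $ k) differentiable_on UNIV"
    and "f \<in> borel_measurable borel"
    and "integrable (obs_measure H \<sigma> x0) (\<lambda>y. (f y)\<^sup>2)"
    and mean: "\<And>s. has_bochner_integral (obs_measure H \<sigma> (embed_vec \<kappa> s)) f (\<gamma> (embed_vec \<kappa> s) $ k)"
  shows "(\<integral>y. (f y)\<^sup>2 \<partial>obs_measure H \<sigma> x0) \<ge> L_bound H \<sigma> \<gamma> k \<kappa> x0 + (\<gamma> x0 $ k)\<^sup>2"
proof -
  define A where "A = sub_matrix H \<kappa>"
  define s0 where "s0 = s0_vec H \<kappa> x0"
  define r where "r = grad_vec \<gamma> k \<kappa> s0"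
  \<comment> \<open>For a general direction the limiting bound contains 2 (r \<bullet> h) - |A h|^2
    / \<open>\<sigma>\<^sup>2\<close>. This \<open>h\<close> maximises it, and both r \<bullet> h
    and |A h|^2 / \<open>\<sigma>\<^sup>2\<close> then equal \<open>q\<close>.\<close>
  define h where "h = \<sigma>\<^sup>2 *\<^sub>R (gram_inv H \<kappa> *v r)"
  \<comment> \<open>The least-squares residual of \<open>H *v x0\<close>; the normal equations make
    it orthogonal to the range of \<open>A\<close>.\<close>
  define w where "w = H *v x0 - A *v s0"
  define g where "g = (\<lambda>t::real. \<gamma> (embed_vec \<kappa> (s0 + t *\<^sub>R h)) $ k)"
  define \<beta> where "\<beta> = beta_fac H \<sigma> \<kappa> x0"
  define q where "q = r \<bullet> h"
  define E where "E = (\<integral>y. (f y)\<^sup>2 \<partial>obs_measure H \<sigma> x0)"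
  note gram = gram_mult_gram_inv [OF assms(1,2), folded A_def]
  have "\<beta> > 0"
    by (simp add: \<beta>_def beta_fac_def)
  have orth: "(A *v v) \<bullet> w = 0" for v
  proof -
    have "transpose A *v w = 0"
      unfolding w_def s0_def s0_vec_def sub_pinv_def matrix_vector_mult_diff_distrib
        matrix_vector_mul_assoc [symmetric] A_def [symmetric] gram by simp
    then show ?thesis
      using dot_lmul_matrix [of w A v] by (simp add: inner_commute transpose_matrix_vector)
  qed
  have Ah: "(A *v h) \<bullet> (A *v h) = \<sigma>\<^sup>2 * q"
  proof -
    have "(A *v h) \<bullet> (A *v h) = (transpose A *v (A *v h)) \<bullet> h"
      by (simp add: dot_lmul_matrix)
    also have "transpose A *v (A *v h) = \<sigma>\<^sup>2 *\<^sub>R r"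
      unfolding h_def matrix_vector_mult_scaleR gram ..
    finally show ?thesis
      by (simp add: q_def)
  qed
  then have "q \<ge> 0"
    using \<sigma> inner_ge_zero [of "A *v h"] by (metis zero_le_mult_iff not_le)
  \<comment> \<open>This is the squared norm of the likelihood ratio at \<open>s0\<close>; squaring
    \<open>beta_fac\<close> removes the 1/2 in its exponent.\<close>
  have \<beta>_w: "exp (w \<bullet> w / \<sigma>\<^sup>2) = 1 / \<beta>\<^sup>2"
  proof -
    have "(mat 1 - sub_proj H \<kappa>) *v (H *v x0) = w"
      unfolding w_def sub_proj_def s0_def s0_vec_def A_def matrix_vector_mult_diff_rdistrib
        matrix_vector_mul_assoc [symmetric] by simp
    then have "\<beta>\<^sup>2 = exp (- (w \<bullet> w / \<sigma>\<^sup>2))"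
      using \<sigma> by (simp add: \<beta>_def beta_fac_def power2_norm_eq_inner exp_double [symmetric])
    then show ?thesis
      by (simp add: exp_minus inverse_eq_divide)
  qed
  have diff: "H *v (embed_vec \<kappa> (s0 + t *\<^sub>R h) - x0) = t *\<^sub>R (A *v h) - w" for t
    by (simp add: matrix_vector_mult_diff_distrib matrix_vector_mult_embed_vec [OF assms(1)]
        matrix_vector_right_distrib matrix_vector_mult_scaleR w_def A_def)
  have kernel: "exp ((H *v (embed_vec \<kappa> (s0 + t *\<^sub>R h) - x0)) \<bullet>
      (H *v (embed_vec \<kappa> (s0 + t' *\<^sub>R h) - x0)) / \<sigma>\<^sup>2) = exp (t * t' * q) / \<beta>\<^sup>2" for t t'
  proof -
    have "(t *\<^sub>R (A *v h) - w) \<bullet> (t' *\<^sub>R (A *v h) - w) / \<sigma>\<^sup>2 = t * t' * q + w \<bullet> w / \<sigma>\<^sup>2"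
      using \<sigma> orth [of h] Ah
      by (simp add: inner_diff_left inner_diff_right inner_commute field_simps)
    then show ?thesis
      unfolding diff by (simp add: exp_add \<beta>_w)
  qed
  have "E \<ge> \<beta>\<^sup>2 * (2 * ((g 0)\<^sup>2 + (g t - g 0) / t) - ((g 0)\<^sup>2 + (exp (t\<^sup>2 * q) - 1) / t\<^sup>2))"
    if "t > 0" for t
  proof -
    \<comment> \<open>These make the combination equal to \<open>\<beta>\<^sup>2\<close> times
      \<open>g 0 * \<rho>\<^sub>0 + (\<rho>\<^sub>t - \<rho>\<^sub>0) / t\<close>. By
      \<open>kernel\<close>, \<open>\<rho>\<^sub>0\<close> is orthogonal to the difference quotient,
      so no cross term survives.\<close>
    define a b where "a = \<beta>\<^sup>2 * (g 0 - 1 / t)" and "b = \<beta>\<^sup>2 / t"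
    have "2 * (a * g 0 + b * g t) - (a\<^sup>2 * (exp (0 * 0 * q) / \<beta>\<^sup>2) +
        2 * a * b * (exp (0 * t * q) / \<beta>\<^sup>2) + b\<^sup>2 * (exp (t * t * q) / \<beta>\<^sup>2)) \<le> E"
      unfolding E_def g_def
      \<comment> \<open>The base point is written \<open>s0 + 0 *\<^sub>R h\<close> so that
        \<open>kernel\<close> and \<open>g\<close> apply to both points.\<close>
      using second_moment_ge [OF \<sigma> assms(5,6) mean [of "s0 + 0 *\<^sub>R h"] mean [of "s0 + t *\<^sub>R h"], of a b]
      unfolding kernel by simp
    moreover have "2 * (a * g 0 + b * g t) - (a\<^sup>2 * (exp (0 * 0 * q) / \<beta>\<^sup>2) +
        2 * a * b * (exp (0 * t * q) / \<beta>\<^sup>2) + b\<^sup>2 * (exp (t * t * q) / \<beta>\<^sup>2)) =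
        \<beta>\<^sup>2 * (2 * ((g 0)\<^sup>2 + (g t - g 0) / t) - ((g 0)\<^sup>2 + (exp (t\<^sup>2 * q) - 1) / t\<^sup>2))"
      using that \<open>\<beta> > 0\<close> by (simp add: a_def b_def power2_eq_square field_simps)
    ultimately show ?thesis by simp
  qed
  then have "\<forall>\<^sub>F t in at_right 0.
      \<beta>\<^sup>2 * (2 * ((g 0)\<^sup>2 + (g t - g 0) / t) - ((g 0)\<^sup>2 + (exp (t\<^sup>2 * q) - 1) / t\<^sup>2)) \<le> E"
    by (intro eventually_at_right_less [THEN eventually_mono]) simp
  moreover have "((\<lambda>t. \<beta>\<^sup>2 * (2 * ((g 0)\<^sup>2 + (g t - g 0) / t) - ((g 0)\<^sup>2 + (exp (t\<^sup>2 * q) - 1) / t\<^sup>2)))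
      \<longlongrightarrow> \<beta>\<^sup>2 * (2 * ((g 0)\<^sup>2 + q) - ((g 0)\<^sup>2 + q))) (at_right 0)"
  proof -
    have "(g has_real_derivative q) (at 0)"
      unfolding g_def q_def r_def
      using assms(4) by (intro has_real_derivative_grad_vec) (simp add: differentiable_on_def)
    then have "((\<lambda>t. (g t - g 0) / t) \<longlongrightarrow> q) (at_right 0)"
      using filterlim_at_split [of "\<lambda>t. (g t - g 0) / t" "nhds q" 0]
      by (simp add: DERIV_def)
    moreover have "((\<lambda>t. (exp (t\<^sup>2 * q) - 1) / t\<^sup>2) \<longlongrightarrow> q) (at_right 0)"
    proof (cases "q = 0")
      case True
      then show ?thesis by simp
    next
      case False
      then have "q > 0" using \<open>q \<ge> 0\<close> by simp
      then show ?thesis by real_asymp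
    qed
    ultimately show ?thesis
      by (intro tendsto_intros)
  qed
  ultimately have "\<beta>\<^sup>2 * (2 * ((g 0)\<^sup>2 + q) - ((g 0)\<^sup>2 + q)) \<le> E"
    by (intro tendsto_upperbound) auto
  moreover have "L_bound H \<sigma> \<gamma> k \<kappa> x0 = \<beta>\<^sup>2 * (q + (g 0)\<^sup>2) - (\<gamma> x0 $ k)\<^sup>2"
    by (simp add: L_bound_def Let_def \<beta>_def q_def g_def h_def r_def s0_def)
  ultimately show ?thesis
    by (simp add: E_def algebra_simps)
qed

section \<open>Passing to the variance: all components and index sets\<close>

theorem mainTheorem1:
  fixes H :: "real ^ 'n ^ 'm"
    and \<sigma> :: real
    and \<gamma> :: "real ^ 'n \<Rightarrow> real ^ 'n"
    and xhat :: "real ^ 'm \<Rightarrow> real ^ 'n"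
    and e :: "'n set \<Rightarrow> 's::finite \<Rightarrow> 'n"
    and x0 :: "real ^ 'n"
  assumes "CARD('s) < CARD('n)"
    and "spark H > enat CARD('s)"
    and "\<sigma>\<^sup>2 > 0"
    and "is_enumeration e"
    and "differentiable_mean e \<gamma>"
    and "xhat \<in> borel_measurable borel"
    and "has_mean_function H \<sigma> xhat (sparse_vectors CARD('s)) \<gamma>"
    and "x0 \<in> sparse_vectors CARD('s)"
  shows "enn2ereal (est_variance H \<sigma> xhat x0) \<ge> ereal (\<Sum>k\<in>UNIV. L_star H \<sigma> e \<gamma> k x0)"
proof (cases "est_variance H \<sigma> xhat x0 = \<infinity>")
  case True
  then show ?thesis by simp
next
  \<comment> \<open>Finite variance makes every component square integrable under \<open>x0\<close>,
    as the second-moment bound requires.\<close>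
  case False
  let ?M = "obs_measure H \<sigma> x0"
  interpret prob_space ?M
    by (rule prob_space_obs_measure) fact
  note [measurable] = assms(6)
  have mean: "has_bochner_integral (obs_measure H \<sigma> x) (\<lambda>y. xhat y $ k) (\<gamma> x $ k)"
    if "x \<in> sparse_vectors CARD('s)" for x k
    using assms(7) that has_bochner_integral_bounded_linear [OF bounded_linear_vec_nth]
    unfolding has_mean_function_def by blast
  have comp_measurable [measurable]: "(\<lambda>y. xhat y $ k) \<in> borel_measurable borel" for k
    by (rule borel_measurable_continuous_on [OF _ assms(6)]) (intro continuous_intros)
  have mean0: "integral\<^sup>L ?M xhat = \<gamma> x0"
    using assms(7,8) by (auto simp: has_mean_function_def has_bochner_integral_iff)
  have norm_sum: "(norm (xhat y - \<gamma> x0))\<^sup>2 = (\<Sum>k\<in>UNIV. (xhat y $ k - \<gamma> x0 $ k)\<^sup>2)" for y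
    unfolding power2_norm_eq_inner inner_vec_def by (simp add: power2_eq_square)
  have int_norm: "integrable ?M (\<lambda>y. (norm (xhat y - \<gamma> x0))\<^sup>2)"
    using False by (intro integrableI_bounded) (simp_all add: est_variance_def mean0 top.not_eq_extremum)
  have int_comp: "integrable ?M (\<lambda>y. (xhat y $ k - \<gamma> x0 $ k)\<^sup>2)" for k
  proof (rule Bochner_Integration.integrable_bound [OF int_norm])
    show "AE y in ?M. norm ((xhat y $ k - \<gamma> x0 $ k)\<^sup>2) \<le> norm ((norm (xhat y - \<gamma> x0))\<^sup>2)"
      unfolding norm_sum by (intro AE_I2) (auto simp: sum_nonneg intro: member_le_sum)
  qed measurable
  have "L_star H \<sigma> e \<gamma> k x0 \<le> (\<integral>y. (xhat y $ k - \<gamma> x0 $ k)\<^sup>2 \<partial>?M)" for k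
  proof -
    let ?f = "\<lambda>y. xhat y $ k"
    note m0 = mean [OF assms(8), of k]
    \<comment> \<open>Second moment equals variance plus squared mean. The identity transfers
      integrability from the centred square to the uncentred one, and its squared mean cancels the
      one added to \<open>L_bound\<close>.\<close>
    have "has_bochner_integral ?M
        (\<lambda>y. (?f y - \<gamma> x0 $ k)\<^sup>2 + 2 * \<gamma> x0 $ k * ?f y - (\<gamma> x0 $ k)\<^sup>2)
        ((\<integral>y. (?f y - \<gamma> x0 $ k)\<^sup>2 \<partial>?M) + 2 * \<gamma> x0 $ k * \<gamma> x0 $ k - (\<gamma> x0 $ k)\<^sup>2)"
      using int_comp m0
      by (intro has_bochner_integral_add has_bochner_integral_diff has_bochner_integral_mult_right
          has_bochner_integral_integrable) (auto simp: has_bochner_integral_iff prob_space)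
    moreover have "(?f y - \<gamma> x0 $ k)\<^sup>2 + 2 * \<gamma> x0 $ k * ?f y - (\<gamma> x0 $ k)\<^sup>2 = (?f y)\<^sup>2" for y
      by (simp add: power2_eq_square algebra_simps)
    ultimately have sq: "has_bochner_integral ?M (\<lambda>y. (?f y)\<^sup>2)
        ((\<integral>y. (?f y - \<gamma> x0 $ k)\<^sup>2 \<partial>?M) + (\<gamma> x0 $ k)\<^sup>2)"
      by (simp add: power2_eq_square add.commute)
    have "L_bound H \<sigma> \<gamma> k (e K) x0 \<le> (\<integral>y. (?f y - \<gamma> x0 $ k)\<^sup>2 \<partial>?M)" if "card K = CARD('s)" for K
    proof -
      have "inj (e K)"
        using assms(4) that by (auto simp: is_enumeration_def bij_betw_def)
      then have "L_bound H \<sigma> \<gamma> k (e K) x0 + (\<gamma> x0 $ k)\<^sup>2 \<le> (\<integral>y. (?f y)\<^sup>2 \<partial>?M)"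
        using assms(2,3,5) that sq
        by (intro second_moment_ge_L_bound mean embed_vec_in_sparse_vectors)
          (auto simp: differentiable_mean_def has_bochner_integral_iff)
      then show ?thesis
        using sq by (simp add: has_bochner_integral_iff)
    qed
    \<comment> \<open>S < N supplies an index set, so that \<open>Max\<close> ranges over a nonempty
      finite set.\<close>
    moreover have "{K :: 'n set. card K = CARD('s)} \<noteq> {}"
      using obtain_subset_with_card_n [of "CARD('s)" "UNIV :: 'n set"] assms(1) by auto
    ultimately show ?thesis
      unfolding L_star_def by (intro Max.boundedI) auto
  qed
  \<comment> \<open>The maximum was taken for each component separately, so different components may
    use different index sets.\<close>
  then have "(\<Sum>k\<in>UNIV. L_star H \<sigma> e \<gamma> k x0) \<le> (\<Sum>k\<in>UNIV. \<integral>y. (xhat y $ k - \<gamma> x0 $ k)\<^sup>2 \<partial>?M)"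
    by (rule sum_mono)
  also have "\<dots> = (\<integral>y. (norm (xhat y - \<gamma> x0))\<^sup>2 \<partial>?M)"
    unfolding norm_sum by (rule Bochner_Integration.integral_sum [symmetric]) (rule int_comp)
  finally show ?thesis
    using nn_integral_eq_integral [OF int_norm]
    by (simp add: est_variance_def mean0 enn2ereal_ennreal)
qed

end
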